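(* Let $(S,\cdot)$ be a semigroup satisfying the Strong F\o lner Condition, let $\sim$ be the relation on $S$ given by $a\sim b$ iff there exists $x\in S$ with $ax=bx$, and let $T=S/\!\sim$ be the quotient semigroup. Then the minimal left ideals of $\beta S$ and of $\beta T$ are isomorphic.
   Context: $S$ satisfies the Strong F\o lner Condition if for every finite nonempty $H\subseteq S$ and $\epsilon>0$ there is a finite nonempty $K\subseteq S$ with $|K\setminus sK|<\epsilon|K|$ for all $s\in H$. Under this condition $\sim$ is a congruence and $T=S/\!\sim$ is a cancellative semigroup (a known fact). $\beta S$ is the set of ultrafilters on $S$, a compact right topological semigroup with operation extending that of $S$ given by: $A\in pq$ iff $\{s\in S:s^{-1}A\in q\}\in p$, where $s^{-1}A=\{t:st\in A\}$; similarly for $\beta T$. A minimal left ideal is a left ideal ($\beta S\,L\subseteq L$, $L\ne\emptyset$) containing no smaller left ideal. *)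

theory Defs
  imports Complex_Main
begin

text \<open>
  Semigroups are given by a carrier set and a multiplication. Explicit carriers are needed because
  the quotient semigroup and the Stone-Cech compactifications are sets depending on the semigroup.
\<close>

definition semigroup_on :: "'a set \<Rightarrow> ('a \<Rightarrow> 'a \<Rightarrow> 'a) \<Rightarrow> bool" where
  "semigroup_on S m \<longleftrightarrow>
     (\<forall>x\<in>S. \<forall>y\<in>S. m x y \<in> S) \<and>
     (\<forall>x\<in>S. \<forall>y\<in>S. \<forall>z\<in>S. m (m x y) z = m x (m y z))"

definition strong_Folner :: "'a set \<Rightarrow> ('a \<Rightarrow> 'a \<Rightarrow> 'a) \<Rightarrow> bool" where
  "strong_Folner S m \<longleftrightarrow>
     (\<forall>H (\<epsilon>::real). H \<subseteq> S \<and> finite H \<and> H \<noteq> {} \<and> \<epsilon> > 0 \<longrightarrow>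
        (\<exists>K. K \<subseteq> S \<and> finite K \<and> K \<noteq> {} \<and>
           (\<forall>s\<in>H. real (card (K - m s ` K)) < \<epsilon> * real (card K))))"

definition cancel_rel :: "'a set \<Rightarrow> ('a \<Rightarrow> 'a \<Rightarrow> 'a) \<Rightarrow> ('a \<times> 'a) set" where
  "cancel_rel S m = {(a, b). a \<in> S \<and> b \<in> S \<and> (\<exists>x\<in>S. m a x = m b x)}"

text \<open>
  The product of two classes is the class of the product of representatives; as usual for
  functions on quotients it is written as a union over all representatives, which is a single
  class whenever the relation is a congruence.
\<close>

definition quotient_mult ::
  "('a \<times> 'a) set \<Rightarrow> ('a \<Rightarrow> 'a \<Rightarrow> 'a) \<Rightarrow> 'a set \<Rightarrow> 'a set \<Rightarrow> 'a set" where
  "quotient_mult r m X Y = (\<Union>x\<in>X. \<Union>y\<in>Y. r `` {m x y})"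

definition ultrafilter_on :: "'a set \<Rightarrow> 'a set set \<Rightarrow> bool" where
  "ultrafilter_on X p \<longleftrightarrow>
     p \<subseteq> Pow X \<and> X \<in> p \<and> {} \<notin> p \<and>
     (\<forall>A\<in>p. \<forall>B\<in>p. A \<inter> B \<in> p) \<and>
     (\<forall>A B. A \<in> p \<and> A \<subseteq> B \<and> B \<subseteq> X \<longrightarrow> B \<in> p) \<and>
     (\<forall>A. A \<subseteq> X \<longrightarrow> A \<in> p \<or> X - A \<in> p)"

definition beta :: "'a set \<Rightarrow> 'a set set set" where
  "beta X = {p. ultrafilter_on X p}"

definition beta_mult ::
  "'a set \<Rightarrow> ('a \<Rightarrow> 'a \<Rightarrow> 'a) \<Rightarrow> 'a set set \<Rightarrow> 'a set set \<Rightarrow> 'a set set" where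
  "beta_mult S m p q = {A. A \<subseteq> S \<and> {s \<in> S. {t \<in> S. m s t \<in> A} \<in> q} \<in> p}"

definition left_ideal :: "'a set \<Rightarrow> ('a \<Rightarrow> 'a \<Rightarrow> 'a) \<Rightarrow> 'a set \<Rightarrow> bool" where
  "left_ideal S m L \<longleftrightarrow> L \<subseteq> S \<and> L \<noteq> {} \<and> (\<forall>s\<in>S. \<forall>x\<in>L. m s x \<in> L)"

definition minimal_left_ideal :: "'a set \<Rightarrow> ('a \<Rightarrow> 'a \<Rightarrow> 'a) \<Rightarrow> 'a set \<Rightarrow> bool" where
  "minimal_left_ideal S m L \<longleftrightarrow>
     left_ideal S m L \<and> (\<forall>L'. left_ideal S m L' \<and> L' \<subseteq> L \<longrightarrow> L' = L)"

definition semigroup_isomorphic ::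
  "'a set \<Rightarrow> ('a \<Rightarrow> 'a \<Rightarrow> 'a) \<Rightarrow> 'b set \<Rightarrow> ('b \<Rightarrow> 'b \<Rightarrow> 'b) \<Rightarrow> bool" where
  "semigroup_isomorphic S m T n \<longleftrightarrow>
     (\<exists>f. bij_betw f S T \<and> (\<forall>x\<in>S. \<forall>y\<in>S. f (m x y) = n (f x) (f y)))"

end

theory Submission
  imports Defs
begin

text \<open>
  The Folner condition makes any two principal right ideals \<open>a \<cdot> S\<close>, \<open>b \<cdot> S\<close> meet, so \<open>cancel_rel\<close> is a
  congruence and the closures of the sets \<open>x \<cdot> S\<close> have a common point in \<open>beta S\<close>. These common points
  form a two-sided ideal, which therefore contains \<open>L\<close>. For such a point \<open>q\<close> the product \<open>p \<cdot> q\<close> depends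
  only on the image of \<open>p\<close> in \<open>beta T\<close>. Since an idempotent of \<open>L\<close> is a right identity of \<open>L\<close>, the
  homomorphism from \<open>beta S\<close> onto \<open>beta T\<close> is injective on \<open>L\<close>. The image of \<open>L\<close> is a minimal left ideal of
  \<open>beta T\<close>, and in any semigroup all minimal left ideals are isomorphic once one of them contains an
  idempotent.
\<close>

section \<open>Minimal left ideals of a semigroup\<close>

locale carrier_semigroup =
  fixes S :: "'a set" and mult :: "'a \<Rightarrow> 'a \<Rightarrow> 'a" (infixl "\<cdot>" 70)
  assumes semigroup: "semigroup_on S mult"
begin

lemma closed [simp, intro]: "x \<in> S \<Longrightarrow> y \<in> S \<Longrightarrow> x \<cdot> y \<in> S"
  using semigroup by (auto simp: semigroup_on_def)

lemma assoc: "x \<in> S \<Longrightarrow> y \<in> S \<Longrightarrow> z \<in> S \<Longrightarrow> (x \<cdot> y) \<cdot> z = x \<cdot> (y \<cdot> z)"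
  using semigroup by (auto simp: semigroup_on_def)

text \<open>Right translation by \<open>x\<close> turns \<open>I\<close> into a left ideal inside
  \<open>L\<close>, so minimality forces equality. With \<open>I = L\<close> every equation
  \<open>a \<cdot> x = y\<close> with \<open>y \<in> L\<close> becomes solvable in
  \<open>L\<close>.\<close>

lemma left_ideal_mult_minimal:
  assumes I: "left_ideal S mult I" and L: "minimal_left_ideal S mult L" and x: "x \<in> L"
  shows "(\<lambda>a. a \<cdot> x) ` I = L"
proof -
  have L': "left_ideal S mult L"
    using L by (simp add: minimal_left_ideal_def)
  have "left_ideal S mult ((\<lambda>a. a \<cdot> x) ` I)"
    unfolding left_ideal_def
  proof (intro conjI ballI)
    show "(\<lambda>a. a \<cdot> x) ` I \<subseteq> S" "(\<lambda>a. a \<cdot> x) ` I \<noteq> {}"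
      using I L' x by (auto simp: left_ideal_def)
    fix s y assume s: "s \<in> S" and "y \<in> (\<lambda>a. a \<cdot> x) ` I"
    then obtain a where a: "a \<in> I" "y = a \<cdot> x" by blast
    have "s \<cdot> y = (s \<cdot> a) \<cdot> x"
      using a s x I L' by (subst assoc) (auto simp: left_ideal_def)
    then show "s \<cdot> y \<in> (\<lambda>a. a \<cdot> x) ` I"
      using a s I by (auto simp: left_ideal_def)
  qed
  moreover have "(\<lambda>a. a \<cdot> x) ` I \<subseteq> L"
    using I L' x by (auto simp: left_ideal_def)
  ultimately show ?thesis
    using L unfolding minimal_left_ideal_def by blast
qed

lemma minimal_left_ideal_subset: "minimal_left_ideal S mult L \<Longrightarrow> x \<in> L \<Longrightarrow> x \<in> S"
  by (auto simp: minimal_left_ideal_def left_ideal_def)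

lemma minimal_left_ideal_mult: "minimal_left_ideal S mult L \<Longrightarrow> s \<in> S \<Longrightarrow> x \<in> L \<Longrightarrow> s \<cdot> x \<in> L"
  by (auto simp: minimal_left_ideal_def left_ideal_def)

text \<open>Every element of \<open>L = L \<cdot> e\<close> has the form \<open>a \<cdot> e\<close>,
  which right multiplication by \<open>e\<close> fixes.\<close>

lemma idempotent_right_identity:
  assumes L: "minimal_left_ideal S mult L" and e: "e \<in> L" "e \<cdot> e = e" and x: "x \<in> L"
  shows "x \<cdot> e = x"
proof -
  have "x \<in> (\<lambda>a. a \<cdot> e) ` L"
    using left_ideal_mult_minimal[OF _ L e(1)] L x by (auto simp: minimal_left_ideal_def)
  then obtain a where "a \<in> L" "x = a \<cdot> e" by blast
  then show ?thesis
    using e assoc minimal_left_ideal_subset[OF L] by metis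
qed

text \<open>Solving \<open>a \<cdot> x = e\<close> in \<open>L\<close> gives the candidate
  \<open>u = x \<cdot> a\<close>. Another such \<open>v\<close> satisfies
  \<open>v \<cdot> u = u\<close> because it fixes \<open>x\<close>, and
  \<open>v \<cdot> u = v\<close> because \<open>u\<close> is a right identity.\<close>

lemma ex1_idempotent_left_identity:
  assumes L: "minimal_left_ideal S mult L" and e: "e \<in> L" "e \<cdot> e = e" and x: "x \<in> L"
  shows "\<exists>!u. u \<in> L \<and> u \<cdot> u = u \<and> u \<cdot> x = x"
proof -
  note sub = minimal_left_ideal_subset[OF L]
  have "e \<in> (\<lambda>a. a \<cdot> x) ` L"
    using left_ideal_mult_minimal[OF _ L x] L e by (auto simp: minimal_left_ideal_def)
  then obtain a where a: "a \<in> L" "a \<cdot> x = e" by auto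
  define u where "u = x \<cdot> a"
  have uL: "u \<in> L"
    using a x sub minimal_left_ideal_mult[OF L] by (simp add: u_def)
  have ux: "u \<cdot> x = x"
    using a x sub assoc idempotent_right_identity[OF L e x] by (simp add: u_def)
  have uu: "u \<cdot> u = u"
    using ux a x uL sub assoc unfolding u_def by metis
  have "v = u" if v: "v \<in> L" "v \<cdot> v = v" "v \<cdot> x = x" for v
  proof -
    have "v \<cdot> u = u"
      using v a x sub assoc unfolding u_def by metis
    then show ?thesis
      using idempotent_right_identity[OF L uL uu v(1)] by simp
  qed
  then show ?thesis
    using uL uu ux by blast
qed

text \<open>If \<open>w \<in> L'\<close> solves \<open>w \<cdot> e = e\<close>, then
  \<open>e' = e \<cdot> w\<close> is the idempotent of \<open>L'\<close> generating the same right
  ideal as \<open>e\<close>. A second one \<open>v\<close> satisfies both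
  \<open>v \<cdot> e' = e'\<close> and \<open>v \<cdot> e' = v\<close>.\<close>

lemma ex1_partner_idempotent:
  assumes L: "minimal_left_ideal S mult L" and L': "minimal_left_ideal S mult L'"
    and e: "e \<in> L" "e \<cdot> e = e"
  shows "\<exists>!e'. e' \<in> L' \<and> e' \<cdot> e' = e' \<and> e \<cdot> e' = e' \<and> e' \<cdot> e = e"
proof -
  note sub = minimal_left_ideal_subset[OF L] minimal_left_ideal_subset[OF L']
  have "e \<in> (\<lambda>a. a \<cdot> e) ` L'"
    using left_ideal_mult_minimal[OF _ L e(1)] L' e by (auto simp: minimal_left_ideal_def)
  then obtain w where w: "w \<in> L'" "w \<cdot> e = e" by auto
  define e' where "e' = e \<cdot> w"
  have 1: "e' \<in> L'"
    using w e sub minimal_left_ideal_mult[OF L'] by (simp add: e'_def)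
  have 2: "e \<cdot> e' = e'"
    using w e sub by (simp add: e'_def flip: assoc)
  have 3: "e' \<cdot> e = e"
    using w e sub by (simp add: e'_def assoc)
  have 4: "e' \<cdot> e' = e'"
    using 1 2 3 e w sub assoc unfolding e'_def by metis
  have "v = e'" if v: "v \<in> L'" "v \<cdot> v = v" "e \<cdot> v = v" "v \<cdot> e = e" for v
  proof -
    have "v \<cdot> e' = e'"
      using v 1 2 e sub assoc by metis
    then show ?thesis
      using idempotent_right_identity[OF L' 1 4 v(1)] by simp
  qed
  then show ?thesis
    using 1 2 3 4 by blast
qed

text \<open>
  A minimal left ideal with an idempotent \<open>e\<close> is the direct product of the left zero semigroup of
  its idempotents and the group \<open>e \<cdot> L\<close>, an element \<open>x\<close> having the coordinates \<open>u\<close> (the idempotent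
  with \<open>u \<cdot> x = x\<close>) and \<open>e \<cdot> x\<close>. Both factors are transported along the bijection between the
  idempotents of \<open>L\<close> and \<open>L'\<close> generating the same right ideal.
\<close>

lemma minimal_left_ideals_isomorphic:
  assumes L: "minimal_left_ideal S mult L" and L': "minimal_left_ideal S mult L'"
    and e: "e \<in> L" "e \<cdot> e = e"
  shows "semigroup_isomorphic L mult L' mult"
proof -
  note sub = minimal_left_ideal_subset[OF L] minimal_left_ideal_subset[OF L']
  note ml = minimal_left_ideal_mult[OF L] minimal_left_ideal_mult[OF L']
  obtain e' where e': "e' \<in> L'" "e' \<cdot> e' = e'" "e \<cdot> e' = e'" "e' \<cdot> e = e"
    using ex1_partner_idempotent[OF L L' e] by blast
  define \<iota> where "\<iota> x = (THE u. u \<in> L \<and> u \<cdot> u = u \<and> u \<cdot> x = x)" for x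
  have \<iota>: "\<iota> x \<in> L" "\<iota> x \<cdot> \<iota> x = \<iota> x" "\<iota> x \<cdot> x = x" if "x \<in> L" for x
    using theI'[OF ex1_idempotent_left_identity[OF L e that]] by (auto simp: \<iota>_def)
  have \<iota>_eq: "\<iota> x = u" if "x \<in> L" "u \<in> L" "u \<cdot> u = u" "u \<cdot> x = x" for x u
    using ex1_idempotent_left_identity[OF L e that(1)] \<iota>[OF that(1)] that by blast
  define \<pi> where "\<pi> u = (THE v. v \<in> L' \<and> v \<cdot> v = v \<and> u \<cdot> v = v \<and> v \<cdot> u = u)" for u
  have \<pi>: "\<pi> u \<in> L'" "\<pi> u \<cdot> \<pi> u = \<pi> u" "u \<cdot> \<pi> u = \<pi> u" "\<pi> u \<cdot> u = u"
    if "u \<in> L" "u \<cdot> u = u" for u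
    using theI'[OF ex1_partner_idempotent[OF L L' that]] by (auto simp: \<pi>_def)
  have \<pi>_eq: "\<pi> u = v" if "u \<in> L" "u \<cdot> u = u" "v \<in> L'" "v \<cdot> v = v" "u \<cdot> v = v" "v \<cdot> u = u" for u v
    using ex1_partner_idempotent[OF L L' that(1,2)] \<pi>[OF that(1,2)] that by blast
  note rid = idempotent_right_identity[OF L] and rid' = idempotent_right_identity[OF L']
  \<comment> \<open>Right multiplication by \<open>e'\<close> carries the group coordinate
    \<open>e \<cdot> x\<close> into \<open>L'\<close>, and right multiplication by \<open>e\<close>
    brings it back, as \<open>e' \<cdot> e = e\<close>.\<close>
  define f where "f x = \<pi> (\<iota> x) \<cdot> (e \<cdot> (x \<cdot> e'))" for x
  have fL: "f x \<in> L'" if "x \<in> L" for x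
    using that \<iota> \<pi> e e' sub by (simp add: f_def ml)
  have ef: "e' \<cdot> f x = e \<cdot> (x \<cdot> e')" if x: "x \<in> L" for x
  proof -
    have "e' \<cdot> f x = (e' \<cdot> \<pi> (\<iota> x)) \<cdot> (e \<cdot> (x \<cdot> e'))"
      using x \<iota> \<pi> e e' sub by (simp add: f_def assoc)
    also have "\<dots> = e' \<cdot> (e \<cdot> (x \<cdot> e'))"
      using rid' \<pi>[OF \<iota>(1,2)[OF x]] e' by simp
    also have "\<dots> = e \<cdot> (x \<cdot> e')"
      using x e e' sub by (simp flip: assoc)
    finally show ?thesis .
  qed
  \<comment> \<open>Only the group coordinate \<open>e' \<cdot> f y\<close> of the second factor
    enters the product; the extra \<open>e\<close> it brings is absorbed by
    \<open>x \<cdot> e = x\<close>.\<close>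
  have hom: "f (x \<cdot> y) = f x \<cdot> f y" if x: "x \<in> L" and y: "y \<in> L" for x y
  proof -
    have "\<iota> (x \<cdot> y) = \<iota> x"
      using x y \<iota>[OF x] sub ml by (intro \<iota>_eq) (simp_all flip: assoc)
    have "f x \<cdot> f y = \<pi> (\<iota> x) \<cdot> (e \<cdot> (x \<cdot> (e' \<cdot> f y)))"
      using x y fL[OF y] \<iota> \<pi> e e' sub by (simp add: f_def[of x] assoc)
    also have "\<dots> = \<pi> (\<iota> x) \<cdot> (e \<cdot> ((x \<cdot> e) \<cdot> (y \<cdot> e')))"
      using x y e e' sub by (simp add: ef assoc)
    also have "\<dots> = f (x \<cdot> y)"
      using x y e e' sub rid[OF e x] \<open>\<iota> (x \<cdot> y) = \<iota> x\<close> by (simp add: f_def assoc)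
    finally show ?thesis by simp
  qed
  have inj: "x = y" if x: "x \<in> L" and y: "y \<in> L" and eq: "f x = f y" for x y
  proof -
    have ex: "e \<cdot> z = (e' \<cdot> f z) \<cdot> e" if "z \<in> L" for z
      using that e e' sub ml rid[OF e] by (simp add: ef assoc)
    have 1: "e \<cdot> x = e \<cdot> y"
      using ex x y eq by simp
    have \<pi>f: "\<pi> (\<iota> z) \<cdot> f z = f z" if z: "z \<in> L" for z
      using z \<iota>[OF z] \<pi>[OF \<iota>(1,2)[OF z]] e e' sub unfolding f_def by (simp flip: assoc)
    \<comment> \<open>Both are the unique idempotent of \<open>L'\<close> that fixes
      \<open>f x = f y\<close> from the left.\<close>
    have "\<pi> (\<iota> x) = \<pi> (\<iota> y)"
      using ex1_idempotent_left_identity[OF L' e'(1,2) fL[OF x]]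
        \<pi>f[OF x] \<pi>f[OF y] \<pi>[OF \<iota>(1,2)[OF x]] \<pi>[OF \<iota>(1,2)[OF y]] eq by metis
    \<comment> \<open>With \<open>v\<close> the common partner, \<open>\<iota> y \<cdot> \<iota> x =
      \<iota> y \<cdot> (v \<cdot> \<iota> x) = v \<cdot> \<iota> x = \<iota> x\<close>.\<close>
    then have "\<iota> y \<cdot> \<iota> x = \<iota> x"
      using \<iota>[OF x] \<iota>[OF y] \<pi>[OF \<iota>(1,2)[OF x]] \<pi>[OF \<iota>(1,2)[OF y]] sub assoc by metis
    then have 2: "\<iota> x = \<iota> y"
      using rid[OF \<iota>(1,2)[OF x] \<iota>(1)[OF y]] by simp
    have "z = \<iota> z \<cdot> (e \<cdot> z)" if z: "z \<in> L" for z
      using z \<iota>[OF z] rid[OF e \<iota>(1)[OF z]] e sub by (simp flip: assoc)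
    then show ?thesis
      using 1 2 x y by metis
  qed
  have surj: "\<exists>x\<in>L. f x = z" if z: "z \<in> L'" for z
  proof -
    obtain v where v: "v \<in> L'" "v \<cdot> v = v" "v \<cdot> z = z"
      using ex1_idempotent_left_identity[OF L' e'(1,2) z] by blast
    obtain u where u: "u \<in> L" "u \<cdot> u = u" "v \<cdot> u = u" "u \<cdot> v = v"
      using ex1_partner_idempotent[OF L' L v(1,2)] by blast
    \<comment> \<open>The preimage has as coordinates the partner \<open>u\<close> of
      \<open>v\<close> in \<open>L\<close> and the group part \<open>e' \<cdot> z\<close>, moved
      back to \<open>L\<close> by \<open>e\<close>.\<close>
    define x where "x = u \<cdot> (e' \<cdot> (z \<cdot> e))"
    have x: "x \<in> L"
      using u e e' z sub by (simp add: x_def ml)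
    have "\<iota> x = u"
      using x u e e' z sub by (intro \<iota>_eq) (simp_all add: x_def flip: assoc)
    moreover have "\<pi> u = v"
      using u v by (intro \<pi>_eq)
    ultimately have "f x = v \<cdot> (e \<cdot> (x \<cdot> e'))"
      by (simp add: f_def)
    also have "\<dots> = v \<cdot> ((e \<cdot> u) \<cdot> (e' \<cdot> (z \<cdot> e')))"
      using v u e e' z sub by (simp add: x_def assoc)
    also have "\<dots> = v \<cdot> ((e \<cdot> e') \<cdot> (z \<cdot> e'))"
      using e e'(1) z sub rid[OF u(1,2) e(1)] by (simp add: assoc)
    also have "\<dots> = (v \<cdot> e') \<cdot> (z \<cdot> e')"
      using v(1) e' z sub by (simp add: assoc)
    also have "\<dots> = z"
      using rid'[OF e'(1,2)] v z by simp
    finally show ?thesis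
      using x by blast
  qed
  have "bij_betw f L L'"
    unfolding bij_betw_def inj_on_def using inj surj fL by blast
  then show ?thesis
    using hom unfolding semigroup_isomorphic_def by blast
qed

end

section \<open>Ultrafilters and the semigroup of ultrafilters\<close>

lemma beta_subset: "p \<in> beta X \<Longrightarrow> A \<in> p \<Longrightarrow> A \<subseteq> X"
  and beta_carrier: "p \<in> beta X \<Longrightarrow> X \<in> p"
  and beta_empty: "p \<in> beta X \<Longrightarrow> {} \<notin> p"
  and beta_Int: "p \<in> beta X \<Longrightarrow> A \<in> p \<Longrightarrow> B \<in> p \<Longrightarrow> A \<inter> B \<in> p"
  and beta_mono: "p \<in> beta X \<Longrightarrow> A \<in> p \<Longrightarrow> A \<subseteq> B \<Longrightarrow> B \<subseteq> X \<Longrightarrow> B \<in> p"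
  by (auto simp: beta_def ultrafilter_on_def)

lemma beta_Diff_iff:
  assumes "p \<in> beta X" "A \<subseteq> X"
  shows "X - A \<in> p \<longleftrightarrow> A \<notin> p"
proof
  show "A \<notin> p" if "X - A \<in> p"
    using beta_Int[OF assms(1) that, of A] beta_empty[OF assms(1)] by (auto simp: Int_commute)
  show "X - A \<in> p" if "A \<notin> p"
    using assms that unfolding beta_def ultrafilter_on_def by blast
qed

lemma beta_Int_iff: "p \<in> beta X \<Longrightarrow> A \<subseteq> X \<Longrightarrow> B \<subseteq> X \<Longrightarrow> A \<inter> B \<in> p \<longleftrightarrow> A \<in> p \<and> B \<in> p"
  using beta_Int[of p X] beta_mono[of p X "A \<inter> B"] by blast

text \<open>Stated with equivalences so that, for products and images, it reduces to the
  compatibility of preimages with complements and intersections. Upward closure comes from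
  \<open>A \<inter> B = A\<close>.\<close>

lemma betaI:
  assumes "\<And>A. A \<in> p \<Longrightarrow> A \<subseteq> X" "X \<in> p"
    and "\<And>A. A \<subseteq> X \<Longrightarrow> X - A \<in> p \<longleftrightarrow> A \<notin> p"
    and "\<And>A B. A \<subseteq> X \<Longrightarrow> B \<subseteq> X \<Longrightarrow> A \<inter> B \<in> p \<longleftrightarrow> A \<in> p \<and> B \<in> p"
  shows "p \<in> beta X"
  unfolding beta_def ultrafilter_on_def
proof (intro CollectI conjI allI impI ballI)
  show "{} \<notin> p"
    using assms(2) assms(3)[of X] by auto
  show "A \<inter> B \<in> p" if "A \<in> p" "B \<in> p" for A B
    using assms(1,4) that by blast
  show "B \<in> p" if "A \<in> p \<and> A \<subseteq> B \<and> B \<subseteq> X" for A B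
    using assms(4)[of A B] that by (auto simp: Int_absorb2)
  show "A \<in> p \<or> X - A \<in> p" if "A \<subseteq> X" for A
    using assms(3) that by blast
qed (use assms in auto)

lemma beta_eqI:
  assumes "p \<in> beta X" "q \<in> beta X" "p \<subseteq> q"
  shows "p = q"
  using assms beta_Diff_iff beta_subset by (metis subsetI subset_antisym subsetD)

lemma beta_Inter:
  assumes "p \<in> beta X" "finite G" "G \<subseteq> p"
  shows "X \<inter> \<Inter>G \<in> p"
  using assms(2,3)
proof (induction G)
  case empty
  then show ?case using beta_carrier[OF assms(1)] by simp
next
  case (insert A G)
  then have "A \<inter> (X \<inter> \<Inter>G) \<in> p"
    using beta_Int[OF assms(1)] by auto
  moreover have "A \<inter> (X \<inter> \<Inter>G) = X \<inter> \<Inter>(insert A G)"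
    by auto
  ultimately show ?case by simp
qed

text \<open>This is the compactness of the space of ultrafilters: Zorn's lemma yields a maximal
  family with the finite intersection property, and such a family is an ultrafilter.\<close>

lemma ultrafilter_extension:
  assumes F: "F \<subseteq> Pow X" and fip: "\<And>G. finite G \<Longrightarrow> G \<subseteq> F \<Longrightarrow> X \<inter> \<Inter>G \<noteq> {}"
  shows "\<exists>p\<in>beta X. F \<subseteq> p"
proof -
  \<comment> \<open>Intersecting with \<open>X\<close> gives the empty \<open>G\<close> the value
    \<open>X\<close> instead of \<open>UNIV\<close>.\<close>
  define P where "P E \<longleftrightarrow> F \<subseteq> E \<and> E \<subseteq> Pow X \<and> (\<forall>G. finite G \<and> G \<subseteq> E \<longrightarrow> X \<inter> \<Inter>G \<noteq> {})" for E
  have "\<exists>M\<in>{E. P E}. \<forall>E\<in>{E. P E}. M \<subseteq> E \<longrightarrow> E = M"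
  proof (rule subset_Zorn_nonempty)
    have "P F"
      using F fip by (simp add: P_def)
    then show "{E. P E} \<noteq> {}"
      by blast
    fix C assume C: "C \<noteq> {}" "subset.chain {E. P E} C"
    then have PC: "P E" if "E \<in> C" for E
      using that unfolding subset_chain_def by blast
    have "X \<inter> \<Inter>G \<noteq> {}" if G: "finite G" "G \<subseteq> \<Union>C" for G
    proof -
      obtain E where "E \<in> C" "G \<subseteq> E"
        using finite_subset_Union_chain[OF G C] by blast
      then show ?thesis
        using PC G(1) by (simp add: P_def)
    qed
    moreover have "F \<subseteq> E" "E \<subseteq> Pow X" if "E \<in> C" for E
      using PC[OF that] by (simp_all add: P_def)
    then have "F \<subseteq> \<Union>C" "\<Union>C \<subseteq> Pow X"
      using C(1) by blast+
    ultimately show "\<Union>C \<in> {E. P E}"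
      by (simp add: P_def)
  qed
  then obtain p where p: "P p" and max: "\<And>E. P E \<Longrightarrow> p \<subseteq> E \<Longrightarrow> E = p"
    by blast
  have fip: "X \<inter> \<Inter>G \<noteq> {}" if "finite G" "G \<subseteq> p" for G
    using p that by (simp add: P_def)
  have sub: "A \<subseteq> X" if "A \<in> p" for A
    using p that by (auto simp: P_def)
  \<comment> \<open>A set that meets all finite intersections can be added to \<open>p\<close>, so
    it is in \<open>p\<close> by maximality.\<close>
  have mem: "A \<in> p" if "A \<subseteq> X" and A: "\<And>G. finite G \<Longrightarrow> G \<subseteq> p \<Longrightarrow> X \<inter> \<Inter>G \<inter> A \<noteq> {}" for A
  proof -
    have "X \<inter> \<Inter>G \<noteq> {}" if G: "finite G" "G \<subseteq> insert A p" for G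
    proof -
      have "X \<inter> \<Inter>(G - {A}) \<inter> A \<noteq> {}"
        using G by (intro A) auto
      then show ?thesis
        by blast
    qed
    then have "P (insert A p)"
      using p \<open>A \<subseteq> X\<close> by (simp add: P_def subset_insertI2)
    from max[OF this] show ?thesis
      by blast
  qed
  have dich: "A \<in> p \<or> X - A \<in> p" if A: "A \<subseteq> X" for A
  proof (rule ccontr)
    assume "\<not> ?thesis"
    then have "A \<notin> p" "X - A \<notin> p"
      by auto
    obtain G where G: "finite G" "G \<subseteq> p" "X \<inter> \<Inter>G \<inter> A = {}"
      using mem[OF A] \<open>A \<notin> p\<close> by auto
    obtain H where H: "finite H" "H \<subseteq> p" "X \<inter> \<Inter>H \<inter> (X - A) = {}"
      using mem[OF Diff_subset] \<open>X - A \<notin> p\<close> by metis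
    have "X \<inter> \<Inter>(G \<union> H) = {}"
      using G(3) H(3) by blast
    then show False
      using fip[of "G \<union> H"] G H by simp
  qed
  have up: "B \<in> p" if "finite G" "G \<subseteq> p" "X \<inter> \<Inter>G \<subseteq> B" "B \<subseteq> X" for G B
  proof -
    have "X \<inter> \<Inter>(insert (X - B) G) = {}"
      using that(3) by auto
    then have "X - B \<notin> p"
      using fip[of "insert (X - B) G"] that(1,2) by auto
    then show ?thesis
      using dich[OF that(4)] by simp
  qed
  have "p \<in> beta X"
  proof (rule betaI)
    show "X \<in> p"
      using up[of "{}"] by simp
    show "X - A \<in> p \<longleftrightarrow> A \<notin> p" if "A \<subseteq> X" for A
      using fip[of "{A, X - A}"] dich[OF that] by auto
    show "A \<inter> B \<in> p \<longleftrightarrow> A \<in> p \<and> B \<in> p" if "A \<subseteq> X" "B \<subseteq> X" for A B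
    proof
      show "A \<in> p \<and> B \<in> p" if "A \<inter> B \<in> p"
        using up[of "{A \<inter> B}"] that \<open>A \<subseteq> X\<close> \<open>B \<subseteq> X\<close> by (simp add: le_infI1 le_infI2)
      show "A \<inter> B \<in> p" if "A \<in> p \<and> B \<in> p"
        using that \<open>A \<subseteq> X\<close> by (intro up[of "{A, B}"]) auto
    qed
  qed (rule sub)
  then show ?thesis
    using p by (auto simp: P_def)
qed

section \<open>Products of ultrafilters and idempotents in closed subsemigroups\<close>

context carrier_semigroup
begin

text \<open>For \<open>A \<subseteq> S\<close>, the product of \<open>p\<close> and \<open>q\<close>
  contains \<open>A\<close> iff \<open>p\<close> contains this set, so the operator is dual to right
  translation by \<open>q\<close>. For an ultrafilter \<open>q\<close> it respects complements and
  intersections.\<close>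

definition translate_preimage :: "'a set set \<Rightarrow> 'a set \<Rightarrow> 'a set" where
  "translate_preimage q A = {s \<in> S. {t \<in> S. s \<cdot> t \<in> A} \<in> q}"

lemma in_beta_mult: "A \<in> beta_mult S mult p q \<longleftrightarrow> A \<subseteq> S \<and> translate_preimage q A \<in> p"
  by (simp add: beta_mult_def translate_preimage_def)

lemma translate_preimage_subset: "translate_preimage q A \<subseteq> S"
  by (auto simp: translate_preimage_def)

lemma translate_preimage_carrier: "q \<in> beta S \<Longrightarrow> translate_preimage q S = S"
  by (auto simp: translate_preimage_def beta_carrier cong: conj_cong)

lemma translate_preimage_Diff:
  assumes "q \<in> beta S"
  shows "translate_preimage q (S - A) = S - translate_preimage q A"
proof -
  have "{t \<in> S. s \<cdot> t \<in> S - A} = S - {t \<in> S. s \<cdot> t \<in> A}" if "s \<in> S" for s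
    using that by auto
  then show ?thesis
    using beta_Diff_iff[OF assms] by (auto simp: translate_preimage_def)
qed

lemma translate_preimage_Int:
  assumes "q \<in> beta S"
  shows "translate_preimage q (A \<inter> B) = translate_preimage q A \<inter> translate_preimage q B"
proof -
  have "{t \<in> S. s \<cdot> t \<in> A \<inter> B} = {t \<in> S. s \<cdot> t \<in> A} \<inter> {t \<in> S. s \<cdot> t \<in> B}" for s
    by auto
  then show ?thesis
    using beta_Int_iff[OF assms] by (auto simp: translate_preimage_def)
qed

lemma beta_mult_closed:
  assumes p: "p \<in> beta S" and q: "q \<in> beta S"
  shows "beta_mult S mult p q \<in> beta S"
proof (rule betaI)
  show "S \<in> beta_mult S mult p q"
    by (simp add: in_beta_mult translate_preimage_carrier[OF q] beta_carrier[OF p])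
  show "S - A \<in> beta_mult S mult p q \<longleftrightarrow> A \<notin> beta_mult S mult p q" if "A \<subseteq> S" for A
    using that by (simp add: in_beta_mult translate_preimage_Diff[OF q]
        beta_Diff_iff[OF p translate_preimage_subset])
  show "A \<inter> B \<in> beta_mult S mult p q \<longleftrightarrow> A \<in> beta_mult S mult p q \<and> B \<in> beta_mult S mult p q"
    if "A \<subseteq> S" "B \<subseteq> S" for A B
    using that by (auto simp: in_beta_mult translate_preimage_Int[OF q]
        beta_Int_iff[OF p translate_preimage_subset translate_preimage_subset])
qed (simp add: in_beta_mult)

text \<open>Associativity of the product of ultrafilters in dual form; it reduces to
  \<open>(s \<cdot> t) \<cdot> u = s \<cdot> (t \<cdot> u)\<close> in \<open>S\<close>.\<close>

lemma translate_preimage_mult: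
  assumes "A \<subseteq> S"
  shows "translate_preimage (beta_mult S mult q r) A = translate_preimage q (translate_preimage r A)"
proof -
  have "translate_preimage r {t \<in> S. s \<cdot> t \<in> A} = {t \<in> S. s \<cdot> t \<in> translate_preimage r A}"
    if "s \<in> S" for s
  proof -
    have "{u \<in> S. u \<in> S \<and> t \<cdot> u \<in> S \<and> s \<cdot> (t \<cdot> u) \<in> A} = {u \<in> S. s \<cdot> t \<cdot> u \<in> A}" if "t \<in> S" for t
      using that \<open>s \<in> S\<close> by (auto simp: assoc)
    then show ?thesis
      using that by (auto simp: translate_preimage_def assoc cong: conj_cong)
  qed
  then show ?thesis
    by (auto simp: translate_preimage_def[of "beta_mult S mult q r"] in_beta_mult
        translate_preimage_def[of q])
qed

lemma semigroup_beta: "semigroup_on (beta S) (beta_mult S mult)"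
  unfolding semigroup_on_def
  by (auto intro!: beta_mult_closed
      simp: set_eq_iff in_beta_mult translate_preimage_mult translate_preimage_subset)

text \<open>Right translation by \<open>p\<close> is continuous on a compact space, so it maps the
  closed set of ultrafilters extending \<open>F\<close> to a closed set. \<open>F'\<close> collects
  the sets common to all image points, and every ultrafilter extending \<open>F'\<close> is an image
  point.\<close>

lemma closed_right_translate:
  assumes p: "p \<in> beta S" and F: "F \<subseteq> Pow S"
  defines "F' \<equiv> {A. A \<subseteq> S \<and> (\<forall>q\<in>beta S. F \<subseteq> q \<longrightarrow> A \<in> beta_mult S mult q p)}"
  assumes r: "r \<in> beta S" "F' \<subseteq> r"
  shows "\<exists>q\<in>beta S. F \<subseteq> q \<and> beta_mult S mult q p = r"
proof -
  \<comment> \<open>Mapping \<open>q\<close> to \<open>r\<close> means that \<open>q\<close>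
    contains \<open>translate_preimage p\<close> applied to every member of
    \<open>r\<close>.\<close>
  have "\<exists>q\<in>beta S. F \<union> translate_preimage p ` r \<subseteq> q"
  proof (rule ultrafilter_extension)
    show "F \<union> translate_preimage p ` r \<subseteq> Pow S"
      using F translate_preimage_subset by blast
    fix G assume G: "finite G" "G \<subseteq> F \<union> translate_preimage p ` r"
    then have "finite (G - F)" "G - F \<subseteq> translate_preimage p ` r"
      by auto
    then obtain R where R: "finite R" "R \<subseteq> r" "G - F = translate_preimage p ` R"
      by (meson finite_subset_image)
    \<comment> \<open>The finitely many conditions coming from \<open>r\<close> combine into the
      single set \<open>A\<close>. Since \<open>S - A\<close> is outside \<open>F'\<close>, some
      \<open>q\<close> extending \<open>F\<close> satisfies them all.\<close>
    define A where "A = S \<inter> \<Inter>R"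
    have A: "A \<in> r"
      using beta_Inter[OF r(1) R(1,2)] by (simp add: A_def)
    then have "S - A \<notin> r"
      using beta_Diff_iff[OF r(1)] beta_subset[OF r(1)] by blast
    then have "S - A \<notin> F'"
      using r(2) by blast
    then obtain q where q: "q \<in> beta S" "F \<subseteq> q" "S - A \<notin> beta_mult S mult q p"
      unfolding F'_def by blast
    then have "A \<in> beta_mult S mult q p"
      using beta_Diff_iff[OF beta_mult_closed[OF q(1) p]] by (auto simp: A_def)
    then have "\<forall>B\<in>R. B \<in> beta_mult S mult q p"
      using beta_mono[OF beta_mult_closed[OF q(1) p]] beta_subset[OF r(1)] R(2)
      unfolding A_def by blast
    then have "G - F \<subseteq> q"
      unfolding R(3) by (auto simp: in_beta_mult)
    then have "G \<subseteq> q"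
      using q by blast
    then show "S \<inter> \<Inter>G \<noteq> {}"
      using beta_Inter[OF q(1) G(1)] beta_empty[OF q(1)] by auto
  qed
  then obtain q where q: "q \<in> beta S" "F \<subseteq> q" "translate_preimage p ` r \<subseteq> q"
    by auto
  have "r \<subseteq> beta_mult S mult q p"
    using q(3) beta_subset[OF r(1)] by (auto simp: in_beta_mult)
  then show ?thesis
    using q beta_eqI[OF r(1) beta_mult_closed[OF q(1) p]] by auto
qed

text \<open>
  The Ellis-Numakura lemma. A closed subset of \<open>beta S\<close> is represented as the set of ultrafilters
  extending a family \<open>F\<close>, so that a minimal closed subsemigroup corresponds to a maximal \<open>F\<close>.
\<close>

lemma closed_subsemigroup_idempotent:
  assumes F: "F \<subseteq> Pow S" and ne: "\<exists>p\<in>beta S. F \<subseteq> p"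
    and cl: "\<And>p q. p \<in> beta S \<Longrightarrow> q \<in> beta S \<Longrightarrow> F \<subseteq> p \<Longrightarrow> F \<subseteq> q \<Longrightarrow> F \<subseteq> beta_mult S mult p q"
  shows "\<exists>e\<in>beta S. F \<subseteq> e \<and> beta_mult S mult e e = e"
proof -
  define P where "P E \<longleftrightarrow> F \<subseteq> E \<and> E \<subseteq> Pow S \<and> (\<exists>p\<in>beta S. E \<subseteq> p) \<and>
    (\<forall>p\<in>beta S. \<forall>q\<in>beta S. E \<subseteq> p \<longrightarrow> E \<subseteq> q \<longrightarrow> E \<subseteq> beta_mult S mult p q)" for E
  have "\<exists>M\<in>{E. P E}. \<forall>E\<in>{E. P E}. M \<subseteq> E \<longrightarrow> E = M"
  proof (rule subset_Zorn_nonempty)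
    have "P F"
      using F ne cl by (simp add: P_def)
    then show "{E. P E} \<noteq> {}"
      by blast
    fix C assume C: "C \<noteq> {}" "subset.chain {E. P E} C"
    then have PC: "P E" if "E \<in> C" for E
      using that unfolding subset_chain_def by blast
    \<comment> \<open>Compactness: finitely many members of the union already lie in one family of
      the chain, which extends to an ultrafilter.\<close>
    have "\<exists>p\<in>beta S. \<Union>C \<subseteq> p"
    proof (rule ultrafilter_extension)
      show "\<Union>C \<subseteq> Pow S"
        using PC by (simp add: P_def Sup_le_iff)
      fix G assume G: "finite G" "G \<subseteq> \<Union>C"
      obtain E where E: "E \<in> C" "G \<subseteq> E"
        using finite_subset_Union_chain[OF G C] by blast
      from PC[OF E(1)] have "\<exists>p\<in>beta S. E \<subseteq> p"
        by (simp add: P_def)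
      then obtain p where "p \<in> beta S" "G \<subseteq> p"
        using E(2) by blast
      then show "S \<inter> \<Inter>G \<noteq> {}"
        using beta_Inter[OF _ G(1)] beta_empty by metis
    qed
    moreover have "\<Union>C \<subseteq> beta_mult S mult p q"
      if "p \<in> beta S" "q \<in> beta S" "\<Union>C \<subseteq> p" "\<Union>C \<subseteq> q" for p q
    proof (rule Union_least)
      fix E assume "E \<in> C"
      then show "E \<subseteq> beta_mult S mult p q"
        using that PC[of E] by (simp add: P_def Sup_le_iff)
    qed
    moreover have "F \<subseteq> E" "E \<subseteq> Pow S" if "E \<in> C" for E
      using PC[OF that] by (simp_all add: P_def)
    then have "F \<subseteq> \<Union>C" "\<Union>C \<subseteq> Pow S"
      using C(1) by blast+
    ultimately show "\<Union>C \<in> {E. P E}"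
      by (simp add: P_def)
  qed
  then obtain M where M: "P M" and max: "\<And>E. P E \<Longrightarrow> M \<subseteq> E \<Longrightarrow> E = M"
    by blast
  have MS: "M \<subseteq> Pow S" and FM: "F \<subseteq> M"
    using M by (auto simp: P_def)
  have Mcl: "M \<subseteq> beta_mult S mult p q" if "p \<in> beta S" "q \<in> beta S" "M \<subseteq> p" "M \<subseteq> q" for p q
    using M that by (simp add: P_def)
  have "\<exists>p\<in>beta S. M \<subseteq> p"
    using M by (simp add: P_def)
  then obtain p where p: "p \<in> beta S" "M \<subseteq> p"
    by blast
  interpret beta: carrier_semigroup "beta S" "beta_mult S mult"
    by unfold_locales (rule semigroup_beta)
  define M' where "M' = {A. A \<subseteq> S \<and> (\<forall>q\<in>beta S. M \<subseteq> q \<longrightarrow> A \<in> beta_mult S mult q p)}"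
  note M'_translate = closed_right_translate[OF p(1) MS, folded M'_def]
  \<comment> \<open>The ultrafilters extending \<open>M \<union> M'\<close> are the products
    \<open>s \<cdot> p\<close> with \<open>s\<close> extending \<open>M\<close>. They are closed
    under products because \<open>q \<cdot> (s \<cdot> p) = (q \<cdot> s) \<cdot> p\<close>.
    Maximality of \<open>M\<close> then makes \<open>p\<close> itself such a product.\<close>
  have "P (M \<union> M')"
    unfolding P_def
  proof (intro conjI ballI impI)
    have "M \<union> M' \<subseteq> beta_mult S mult p p"
      using Mcl[OF p(1) p(1)] p by (auto simp: M'_def)
    then show "\<exists>r\<in>beta S. M \<union> M' \<subseteq> r"
      using p(1) by blast
    fix q r assume q: "q \<in> beta S" "M \<union> M' \<subseteq> q" and r: "r \<in> beta S" "M \<union> M' \<subseteq> r"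
    obtain s where s: "s \<in> beta S" "M \<subseteq> s" "beta_mult S mult s p = r"
      using M'_translate[of r] r by auto
    have "beta_mult S mult q r = beta_mult S mult (beta_mult S mult q s) p"
      using beta.assoc q(1) s p(1) by auto
    moreover have "M \<subseteq> beta_mult S mult q s"
      using Mcl q s by blast
    ultimately have "M' \<subseteq> beta_mult S mult q r"
      using q(1) s(1) by (auto simp: M'_def)
    then show "M \<union> M' \<subseteq> beta_mult S mult q r"
      using Mcl q r by blast
  qed (use MS FM in \<open>auto simp: M'_def\<close>)
  then have "M' \<subseteq> M"
    using max by blast
  then obtain q where q: "q \<in> beta S" "M \<subseteq> q" "beta_mult S mult q p = p"
    using M'_translate[of p] p by blast
  \<comment> \<open>The extensions of \<open>N\<close> form the stabilizer of \<open>p\<close> among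
    the extensions of \<open>M\<close>. It is a nonempty closed subsemigroup, so by maximality it
    contains \<open>p\<close>, and \<open>p\<close> is idempotent.\<close>
  define N where "N = M \<union> translate_preimage p ` p"
  have N: "N \<subseteq> r \<longleftrightarrow> M \<subseteq> r \<and> beta_mult S mult r p = p" if "r \<in> beta S" for r
  proof -
    have "translate_preimage p ` p \<subseteq> r \<longleftrightarrow> p \<subseteq> beta_mult S mult r p"
      using beta_subset[OF p(1)] by (auto simp: in_beta_mult)
    then show ?thesis
      using beta_eqI[OF p(1) beta_mult_closed[OF that p(1)]] by (auto simp: N_def)
  qed
  have "P N"
    unfolding P_def
  proof (intro conjI ballI impI)
    show "\<exists>r\<in>beta S. N \<subseteq> r"
      using N q by blast
    show "N \<subseteq> Pow S" "F \<subseteq> N"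
      using MS FM translate_preimage_subset unfolding N_def by blast+
    fix r s assume "r \<in> beta S" "s \<in> beta S" "N \<subseteq> r" "N \<subseteq> s"
    then show "N \<subseteq> beta_mult S mult r s"
      using N Mcl beta.assoc p(1) by auto
  qed
  then have "N = M"
    using max by (simp add: N_def)
  then show ?thesis
    using N[OF p(1)] p FM by blast
qed

text \<open>For \<open>p \<in> L\<close>, the ideal \<open>L\<close> is the right translate of the
  whole space by \<open>p\<close>. It is therefore a closed subsemigroup, to which the
  Ellis-Numakura lemma applies.\<close>

lemma minimal_left_ideal_beta_idempotent:
  assumes L: "minimal_left_ideal (beta S) (beta_mult S mult) L"
  shows "\<exists>e\<in>L. beta_mult S mult e e = e"
proof -
  interpret beta: carrier_semigroup "beta S" "beta_mult S mult"
    by unfold_locales (rule semigroup_beta)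
  obtain p where p: "p \<in> L"
    using L by (auto simp: minimal_left_ideal_def left_ideal_def)
  then have pS: "p \<in> beta S"
    using beta.minimal_left_ideal_subset[OF L] by blast
  have "left_ideal (beta S) (beta_mult S mult) (beta S)"
    using pS beta.closed by (auto simp: left_ideal_def)
  then have L_eq: "(\<lambda>q. beta_mult S mult q p) ` beta S = L"
    using beta.left_ideal_mult_minimal L p by blast
  \<comment> \<open>This is the family \<open>F'\<close> of \<open>closed_right_translate\<close>
    for the empty family, whose extensions are all ultrafilters.\<close>
  define F where "F = {A. A \<subseteq> S \<and> (\<forall>q\<in>beta S. {} \<subseteq> q \<longrightarrow> A \<in> beta_mult S mult q p)}"
  have F: "F \<subseteq> q \<longleftrightarrow> q \<in> L" if "q \<in> beta S" for q
  proof
    assume "F \<subseteq> q"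
    then show "q \<in> L"
      using closed_right_translate[OF pS empty_subsetI that, folded F_def] L_eq by blast
  next
    assume "q \<in> L"
    then show "F \<subseteq> q"
      using L_eq by (auto simp: F_def)
  qed
  have "\<exists>e\<in>beta S. F \<subseteq> e \<and> beta_mult S mult e e = e"
  proof (rule closed_subsemigroup_idempotent)
    show "\<exists>p\<in>beta S. F \<subseteq> p"
      using F pS p by blast
    show "F \<subseteq> beta_mult S mult q r" if "q \<in> beta S" "r \<in> beta S" "F \<subseteq> q" "F \<subseteq> r" for q r
      using that F beta.closed beta.minimal_left_ideal_mult[OF L] by simp
  qed (auto simp: F_def)
  then show ?thesis
    using F by blast
qed

end

section \<open>Homomorphic images\<close>

lemma minimal_left_ideal_image:
  assumes L: "minimal_left_ideal S m L"
    and closed: "\<And>x y. x \<in> S \<Longrightarrow> y \<in> S \<Longrightarrow> m x y \<in> S"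
    and surj: "h ` S = T"
    and hom: "\<And>x y. x \<in> S \<Longrightarrow> y \<in> S \<Longrightarrow> h (m x y) = n (h x) (h y)"
  shows "minimal_left_ideal T n (h ` L)"
  unfolding minimal_left_ideal_def
proof (intro conjI allI impI)
  have LS: "L \<subseteq> S" and ne: "L \<noteq> {}" and Lm: "\<And>s x. s \<in> S \<Longrightarrow> x \<in> L \<Longrightarrow> m s x \<in> L"
    using L by (auto simp: minimal_left_ideal_def left_ideal_def)
  have "n t (h x) \<in> h ` L" if t: "t \<in> T" and x: "x \<in> L" for t x
  proof -
    obtain s where "s \<in> S" "t = h s"
      using surj t by blast
    then show ?thesis
      using hom[of s x] Lm[of s x] LS x by (metis imageI subsetD)
  qed
  then show "left_ideal T n (h ` L)"
    using LS ne surj by (auto simp: left_ideal_def)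
  fix J assume J: "left_ideal T n J \<and> J \<subseteq> h ` L"
  define J' where "J' = {x \<in> L. h x \<in> J}"
  have "left_ideal S m J'"
    unfolding left_ideal_def
  proof (intro conjI ballI)
    show "J' \<subseteq> S" "J' \<noteq> {}"
      using J LS by (auto simp: J'_def left_ideal_def)
    show "m s x \<in> J'" if "s \<in> S" "x \<in> J'" for s x
      using that J Lm hom LS surj by (auto simp: J'_def left_ideal_def)
  qed
  moreover have "J' \<subseteq> L"
    by (auto simp: J'_def)
  ultimately have "J' = L"
    using L by (simp add: minimal_left_ideal_def)
  then show "J = h ` L"
    using J by (auto simp: J'_def)
qed

lemma semigroup_isomorphic_trans:
  assumes "semigroup_isomorphic A a B b" "semigroup_isomorphic B b C c"
  shows "semigroup_isomorphic A a C c"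
proof -
  obtain f where f: "bij_betw f A B" "\<forall>x\<in>A. \<forall>y\<in>A. f (a x y) = b (f x) (f y)"
    using assms by (auto simp: semigroup_isomorphic_def)
  obtain g where g: "bij_betw g B C" "\<forall>x\<in>B. \<forall>y\<in>B. g (b x y) = c (g x) (g y)"
    using assms by (auto simp: semigroup_isomorphic_def)
  have "\<forall>x\<in>A. \<forall>y\<in>A. (g \<circ> f) (a x y) = c ((g \<circ> f) x) ((g \<circ> f) y)"
    using f g(2) bij_betwE[OF f(1)] by simp
  then show ?thesis
    using bij_betw_trans[OF f(1) g(1)] unfolding semigroup_isomorphic_def by blast
qed

text \<open>Push-forward of ultrafilters along \<open>h\<close>, that is, the continuous extension
  of \<open>h\<close> when it maps \<open>X\<close> into \<open>Y\<close>.\<close>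

definition beta_map :: "'a set \<Rightarrow> 'b set \<Rightarrow> ('a \<Rightarrow> 'b) \<Rightarrow> 'a set set \<Rightarrow> 'b set set" where
  "beta_map X Y h p = {B. B \<subseteq> Y \<and> {x \<in> X. h x \<in> B} \<in> p}"

lemma beta_map_closed:
  assumes h: "h ` X \<subseteq> Y" and p: "p \<in> beta X"
  shows "beta_map X Y h p \<in> beta Y"
proof (rule betaI)
  have "{x \<in> X. h x \<in> Y} = X"
    using h by auto
  then show "Y \<in> beta_map X Y h p"
    using beta_carrier[OF p] by (simp add: beta_map_def)
  show "Y - B \<in> beta_map X Y h p \<longleftrightarrow> B \<notin> beta_map X Y h p" if "B \<subseteq> Y" for B
  proof -
    have "{x \<in> X. h x \<in> Y - B} = X - {x \<in> X. h x \<in> B}"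
      using h by auto
    then show ?thesis
      using beta_Diff_iff[OF p, of "{x \<in> X. h x \<in> B}"] that by (auto simp: beta_map_def)
  qed
  show "A \<inter> B \<in> beta_map X Y h p \<longleftrightarrow> A \<in> beta_map X Y h p \<and> B \<in> beta_map X Y h p"
    if "A \<subseteq> Y" "B \<subseteq> Y" for A B
  proof -
    have "{x \<in> X. h x \<in> A \<inter> B} = {x \<in> X. h x \<in> A} \<inter> {x \<in> X. h x \<in> B}"
      by auto
    then show ?thesis
      using beta_Int_iff[OF p, of "{x \<in> X. h x \<in> A}" "{x \<in> X. h x \<in> B}"] that
      by (auto simp: beta_map_def)
  qed
qed (simp add: beta_map_def)

text \<open>Pushing \<open>q\<close> forward along a right inverse \<open>g\<close> of
  \<open>h\<close> gives a preimage of \<open>q\<close>.\<close>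

lemma beta_map_image:
  assumes h: "h ` X = Y"
  shows "beta_map X Y h ` beta X = beta Y"
proof
  show "beta_map X Y h ` beta X \<subseteq> beta Y"
    using beta_map_closed[of h X Y] h by blast
  show "beta Y \<subseteq> beta_map X Y h ` beta X"
  proof
    fix q assume q: "q \<in> beta Y"
    define g where "g = inv_into X h"
    have g: "g y \<in> X" "h (g y) = y" if "y \<in> Y" for y
      using that h by (auto simp: g_def inv_into_into f_inv_into_f)
    have "beta_map X Y h (beta_map Y X g q) = q"
    proof (rule set_eqI)
      fix B
      have "{y \<in> Y. g y \<in> {x \<in> X. h x \<in> B}} = B" if "B \<subseteq> Y"
        using g that by auto
      then show "B \<in> beta_map X Y h (beta_map Y X g q) \<longleftrightarrow> B \<in> q"
        using beta_subset[OF q] by (auto simp: beta_map_def)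
    qed
    moreover have "beta_map Y X g q \<in> beta X"
      using g q by (intro beta_map_closed) auto
    ultimately show "q \<in> beta_map X Y h ` beta X"
      by force
  qed
qed

text \<open>Since \<open>h\<close> is a homomorphism, pulling a set back along \<open>h\<close>
  commutes with taking its preimages under left translations.\<close>

lemma beta_map_mult:
  assumes h: "h ` S = T" and m: "\<And>x y. x \<in> S \<Longrightarrow> y \<in> S \<Longrightarrow> m x y \<in> S"
    and hom: "\<And>x y. x \<in> S \<Longrightarrow> y \<in> S \<Longrightarrow> h (m x y) = n (h x) (h y)"
  shows "beta_map S T h (beta_mult S m p q) =
    beta_mult T n (beta_map S T h p) (beta_map S T h q)"
proof -
  have "{s \<in> S. h s \<in> {x \<in> T. {y \<in> T. n x y \<in> B} \<in> beta_map S T h q}} =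
    {s \<in> S. {t \<in> S. m s t \<in> {x \<in> S. h x \<in> B}} \<in> q}" for B
  proof -
    have "h s \<in> {x \<in> T. {y \<in> T. n x y \<in> B} \<in> beta_map S T h q} \<longleftrightarrow>
        {t \<in> S. m s t \<in> {x \<in> S. h x \<in> B}} \<in> q" if s: "s \<in> S" for s
    proof -
      have "{t \<in> S. h t \<in> T \<and> n (h s) (h t) \<in> B} = {t \<in> S. m s t \<in> S \<and> h (m s t) \<in> B}"
        using s h m hom by auto
      then show ?thesis
        using s h by (auto simp: beta_map_def)
    qed
    then show ?thesis
      by blast
  qed
  then show ?thesis
    by (intro set_eqI) (simp add: beta_map_def beta_mult_def)
qed

section \<open>The cancellative quotient\<close>

text \<open>For \<open>H = {a, b}\<close> and \<open>\<epsilon> = 1/2\<close> the two differences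
  each have less than half the size of \<open>K\<close>. They cannot cover \<open>K\<close>, so some
  element of \<open>K\<close> is a multiple of both \<open>a\<close> and \<open>b\<close>.\<close>

lemma strong_Folner_reversible:
  assumes F: "strong_Folner S m" and "a \<in> S" "b \<in> S"
  shows "\<exists>x\<in>S. \<exists>y\<in>S. m a x = m b y"
proof -
  have "{a, b} \<subseteq> S \<and> finite {a, b} \<and> {a, b} \<noteq> {} \<and> (1/2 :: real) > 0"
    using assms by simp
  then obtain K where K: "K \<subseteq> S" "finite K"
    and small: "\<forall>s\<in>{a, b}. real (card (K - m s ` K)) < 1/2 * real (card K)"
    using F unfolding strong_Folner_def by metis
  have "card ((K - m a ` K) \<union> (K - m b ` K)) < card K"
    using small card_Un_le[of "K - m a ` K" "K - m b ` K"] by auto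
  then have "\<not> K \<subseteq> (K - m a ` K) \<union> (K - m b ` K)"
    using card_mono[of "(K - m a ` K) \<union> (K - m b ` K)" K] K(2) by auto
  then show ?thesis
    using K(1) by blast
qed

text \<open>The right Ore condition: the consequence of the Strong Folner Condition on which the
  congruence and the ideal of ultrafilters below rest.\<close>

locale reversible_semigroup = carrier_semigroup +
  assumes reversible: "a \<in> S \<Longrightarrow> b \<in> S \<Longrightarrow> \<exists>x\<in>S. \<exists>y\<in>S. a \<cdot> x = b \<cdot> y"
begin

abbreviation r where "r \<equiv> cancel_rel S mult"

text \<open>For transitivity, the witnesses \<open>x\<close> and \<open>y\<close> of two related
  pairs have a common multiple \<open>x \<cdot> u = y \<cdot> v\<close>, which is a witness for both
  pairs.\<close>

lemma equiv_cancel_rel: "equiv S r"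
proof (rule equivI)
  show "r \<subseteq> S \<times> S"
    by (auto simp: cancel_rel_def)
  show "refl_on S r"
    by (auto simp: refl_on_def cancel_rel_def)
  show "sym r"
    by (auto simp: sym_def cancel_rel_def dest: sym)
  show "trans r"
  proof (rule transI)
    fix a b c assume "(a, b) \<in> r" "(b, c) \<in> r"
    then obtain x y where abc: "a \<in> S" "b \<in> S" "c \<in> S"
      and xy: "x \<in> S" "a \<cdot> x = b \<cdot> x" "y \<in> S" "b \<cdot> y = c \<cdot> y"
      by (auto simp: cancel_rel_def)
    obtain u v where uv: "u \<in> S" "v \<in> S" "x \<cdot> u = y \<cdot> v"
      using reversible[of x y] xy by blast
    have "a \<cdot> (x \<cdot> u) = c \<cdot> (x \<cdot> u)"
      using abc xy uv assoc by metis
    then show "(a, c) \<in> r"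
      using abc xy uv by (auto simp: cancel_rel_def)
  qed
qed

text \<open>Multiplication on the left keeps the witness \<open>x\<close>. Multiplication by
  \<open>c\<close> on the right needs \<open>c \<cdot> u = x \<cdot> v\<close>, and then
  \<open>u\<close> is a witness.\<close>

lemma congruent2_cancel_rel: "(\<lambda>a b. r `` {a \<cdot> b}) respects2 r"
proof (rule congruent2I[OF equiv_cancel_rel equiv_cancel_rel])
  fix a b c assume c: "c \<in> S" and "(a, b) \<in> r"
  then obtain x where ab: "a \<in> S" "b \<in> S" and x: "x \<in> S" "a \<cdot> x = b \<cdot> x"
    by (auto simp: cancel_rel_def)
  obtain u v where uv: "u \<in> S" "v \<in> S" "c \<cdot> u = x \<cdot> v"
    using reversible[of c x] x c by blast
  have "(a \<cdot> c) \<cdot> u = (b \<cdot> c) \<cdot> u"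
    using ab c x uv assoc by metis
  then have "(a \<cdot> c, b \<cdot> c) \<in> r"
    using ab c uv by (auto simp: cancel_rel_def)
  then show "r `` {a \<cdot> c} = r `` {b \<cdot> c}"
    by (rule equiv_class_eq[OF equiv_cancel_rel])
  have "(c \<cdot> a) \<cdot> x = (c \<cdot> b) \<cdot> x"
    using ab c x by (simp add: assoc)
  then have "(c \<cdot> a, c \<cdot> b) \<in> r"
    using ab c x by (auto simp: cancel_rel_def)
  then show "r `` {c \<cdot> a} = r `` {c \<cdot> b}"
    by (rule equiv_class_eq[OF equiv_cancel_rel])
qed

lemma quotient_mult_class:
  "a \<in> S \<Longrightarrow> b \<in> S \<Longrightarrow> quotient_mult r mult (r `` {a}) (r `` {b}) = r `` {a \<cdot> b}"
  unfolding quotient_mult_def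
  by (rule UN_equiv_class2[OF equiv_cancel_rel equiv_cancel_rel congruent2_cancel_rel])

lemma quotient_eq_image: "S // r = (\<lambda>a. r `` {a}) ` S"
  by (auto simp: quotient_def)

lemma semigroup_quotient: "semigroup_on (S // r) (quotient_mult r mult)"
  by (auto simp: semigroup_on_def quotient_eq_image quotient_mult_class assoc)

section \<open>The two-sided ideal of ultrafilters that contain every set
  \<open>x \<cdot> S\<close>\<close>

definition common_multiple_ideal :: "'a set set set" where
  "common_multiple_ideal = {p \<in> beta S. \<forall>x\<in>S. (\<lambda>y. x \<cdot> y) ` S \<in> p}"

text \<open>In the induction, \<open>x\<close> and the common multiple \<open>z\<close> of
  \<open>G\<close> have a common multiple \<open>z \<cdot> v\<close>, which stays in every right
  ideal containing \<open>z\<close>.\<close>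

lemma common_multiple:
  assumes "finite G" "G \<subseteq> S" "S \<noteq> {}"
  shows "\<exists>z\<in>S. \<forall>x\<in>G. z \<in> (\<lambda>y. x \<cdot> y) ` S"
  using assms
proof (induction G)
  case (insert x G)
  then obtain z where z: "z \<in> S" "\<forall>x\<in>G. z \<in> (\<lambda>y. x \<cdot> y) ` S"
    by auto
  obtain u v where uv: "u \<in> S" "v \<in> S" "x \<cdot> u = z \<cdot> v"
    using reversible[of x z] insert.prems z by blast
  have "z \<cdot> v \<in> (\<lambda>y. g \<cdot> y) ` S" if g: "g \<in> G" for g
  proof -
    obtain y where "y \<in> S" "z = g \<cdot> y"
      using z g by auto
    then have "z \<cdot> v = g \<cdot> (y \<cdot> v)"
      using assoc insert.prems g uv by auto
    then show ?thesis
      using \<open>y \<in> S\<close> uv by blast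
  qed
  moreover have "z \<cdot> v \<in> (\<lambda>y. x \<cdot> y) ` S"
    using uv by (metis imageI)
  ultimately show ?case
    using z uv by auto
qed auto

text \<open>Common multiples give the sets \<open>x \<cdot> S\<close> the finite intersection
  property.\<close>

lemma common_multiple_ideal_nonempty:
  assumes "S \<noteq> {}"
  shows "common_multiple_ideal \<noteq> {}"
proof -
  have "\<exists>p\<in>beta S. (\<lambda>x. (\<lambda>y. x \<cdot> y) ` S) ` S \<subseteq> p"
  proof (rule ultrafilter_extension)
    fix G assume "finite G" "G \<subseteq> (\<lambda>x. (\<lambda>y. x \<cdot> y) ` S) ` S"
    then obtain H where "finite H" "H \<subseteq> S" "G = (\<lambda>x. (\<lambda>y. x \<cdot> y) ` S) ` H"
      by (meson finite_subset_image)
    then show "S \<inter> \<Inter>G \<noteq> {}"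
      using common_multiple[OF _ _ assms, of H] by blast
  qed auto
  then show ?thesis
    by (auto simp: common_multiple_ideal_def)
qed

text \<open>As \<open>x \<cdot> S\<close> is a right ideal, each of its elements translates all of
  \<open>S\<close> into it.\<close>

lemma common_multiple_ideal_mult_right:
  assumes p: "p \<in> common_multiple_ideal" and q: "q \<in> beta S"
  shows "beta_mult S mult p q \<in> common_multiple_ideal"
proof -
  have pS: "p \<in> beta S"
    using p by (simp add: common_multiple_ideal_def)
  have "(\<lambda>y. x \<cdot> y) ` S \<in> beta_mult S mult p q" if x: "x \<in> S" for x
  proof -
    have "{t \<in> S. s \<cdot> t \<in> (\<lambda>y. x \<cdot> y) ` S} = S" if "s \<in> (\<lambda>y. x \<cdot> y) ` S" for s
      using that x by (auto simp: assoc)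
    then have "(\<lambda>y. x \<cdot> y) ` S \<subseteq> translate_preimage q ((\<lambda>y. x \<cdot> y) ` S)"
      using x beta_carrier[OF q] by (auto simp: translate_preimage_def)
    then show ?thesis
      using beta_mono[OF pS _ _ translate_preimage_subset] p x
      by (auto simp: in_beta_mult common_multiple_ideal_def)
  qed
  then show ?thesis
    using beta_mult_closed[OF pS q] by (simp add: common_multiple_ideal_def)
qed

text \<open>From \<open>s \<cdot> u = x \<cdot> v\<close> it follows that left translation by
  \<open>s\<close> maps \<open>u \<cdot> S\<close>, a member of \<open>q\<close>, into
  \<open>x \<cdot> S\<close>.\<close>

lemma common_multiple_ideal_mult_left:
  assumes p: "p \<in> beta S" and q: "q \<in> common_multiple_ideal"
  shows "beta_mult S mult p q \<in> common_multiple_ideal"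
proof -
  have qS: "q \<in> beta S"
    using q by (simp add: common_multiple_ideal_def)
  have "(\<lambda>y. x \<cdot> y) ` S \<in> beta_mult S mult p q" if x: "x \<in> S" for x
  proof -
    have "{t \<in> S. s \<cdot> t \<in> (\<lambda>y. x \<cdot> y) ` S} \<in> q" if s: "s \<in> S" for s
    proof -
      obtain u v where uv: "u \<in> S" "v \<in> S" "s \<cdot> u = x \<cdot> v"
        using reversible[of s x] s x by blast
      have "s \<cdot> (u \<cdot> y) = x \<cdot> (v \<cdot> y)" if "y \<in> S" for y
        using uv s x that by (simp flip: assoc)
      then have "(\<lambda>y. u \<cdot> y) ` S \<subseteq> {t \<in> S. s \<cdot> t \<in> (\<lambda>y. x \<cdot> y) ` S}"
        using uv by auto
      moreover have "(\<lambda>y. u \<cdot> y) ` S \<in> q"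
        using q uv(1) by (simp add: common_multiple_ideal_def)
      ultimately show ?thesis
        using beta_mono[OF qS] by blast
    qed
    then have "translate_preimage q ((\<lambda>y. x \<cdot> y) ` S) = S"
      by (auto simp: translate_preimage_def)
    then show ?thesis
      using x beta_carrier[OF p] by (auto simp: in_beta_mult)
  qed
  then show ?thesis
    using beta_mult_closed[OF p qS] by (simp add: common_multiple_ideal_def)
qed

text \<open>Translating this left ideal by some \<open>p \<in> L\<close> gives \<open>L\<close>, and
  the translate stays inside because the ideal is also a right ideal.\<close>

lemma minimal_left_ideal_subset_common_multiple_ideal:
  assumes L: "minimal_left_ideal (beta S) (beta_mult S mult) L"
  shows "L \<subseteq> common_multiple_ideal"
proof -
  interpret beta: carrier_semigroup "beta S" "beta_mult S mult"
    by unfold_locales (rule semigroup_beta)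
  obtain p where p: "p \<in> L"
    using L by (auto simp: minimal_left_ideal_def left_ideal_def)
  then have pS: "p \<in> beta S"
    using beta.minimal_left_ideal_subset[OF L] by blast
  then have "S \<noteq> {}"
    using beta_carrier beta_empty by blast
  then have "left_ideal (beta S) (beta_mult S mult) common_multiple_ideal"
    unfolding left_ideal_def
  proof (intro conjI ballI)
    show "common_multiple_ideal \<subseteq> beta S"
      by (auto simp: common_multiple_ideal_def)
  qed (rule common_multiple_ideal_nonempty common_multiple_ideal_mult_left; assumption)+
  from beta.left_ideal_mult_minimal[OF this L p]
  have "(\<lambda>q. beta_mult S mult q p) ` common_multiple_ideal = L" .
  then show ?thesis
    using common_multiple_ideal_mult_right[OF _ pS] by blast
qed

text \<open>
  If \<open>a \<cdot> x = b \<cdot> x\<close>, then left translation by \<open>a\<close> and by \<open>b\<close> agree on the set \<open>x \<cdot> S\<close>, which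
  belongs to \<open>q\<close>.
\<close>

lemma translate_preimage_cancel_rel:
  assumes q: "q \<in> common_multiple_ideal" and ab: "(a, b) \<in> r" and "a \<in> translate_preimage q A"
  shows "b \<in> translate_preimage q A"
proof -
  have qS: "q \<in> beta S"
    using q by (simp add: common_multiple_ideal_def)
  obtain x where S: "a \<in> S" "b \<in> S" and x: "x \<in> S" "a \<cdot> x = b \<cdot> x"
    using ab by (auto simp: cancel_rel_def)
  have "a \<cdot> t = b \<cdot> t" if "t \<in> (\<lambda>y. x \<cdot> y) ` S" for t
    using S x that by (auto simp flip: assoc)
  then have "{t \<in> S. a \<cdot> t \<in> A} \<inter> (\<lambda>y. x \<cdot> y) ` S \<subseteq> {t \<in> S. b \<cdot> t \<in> A}"
    by (metis (no_types, lifting) IntE mem_Collect_eq subsetI)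
  moreover have "{t \<in> S. a \<cdot> t \<in> A} \<inter> (\<lambda>y. x \<cdot> y) ` S \<in> q"
    using assms x by (intro beta_Int[OF qS]) (auto simp: translate_preimage_def common_multiple_ideal_def)
  ultimately have "{t \<in> S. b \<cdot> t \<in> A} \<in> q"
    using beta_mono[OF qS] by blast
  then show ?thesis
    using S by (simp add: translate_preimage_def)
qed

text \<open>The set \<open>E\<close> deciding whether \<open>A\<close> is in the product is a union
  of classes, so its membership in \<open>p\<close> can be read off from the image of
  \<open>p\<close> over the quotient.\<close>

lemma beta_mult_eq_of_beta_map_eq:
  assumes q: "q \<in> common_multiple_ideal"
    and eq: "beta_map S (S // r) (\<lambda>a. r `` {a}) p = beta_map S (S // r) (\<lambda>a. r `` {a}) p'"
  shows "beta_mult S mult p q = beta_mult S mult p' q"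
proof (rule set_eqI)
  fix A
  define E where "E = translate_preimage q A"
  have "{a \<in> S. r `` {a} \<in> (\<lambda>a. r `` {a}) ` E} = E"
  proof (intro subset_antisym subsetI)
    fix a assume "a \<in> {a \<in> S. r `` {a} \<in> (\<lambda>a. r `` {a}) ` E}"
    then obtain b where b: "b \<in> E" "r `` {a} = r `` {b}" "a \<in> S"
      by auto
    moreover have "b \<in> S"
      using b translate_preimage_subset by (auto simp: E_def)
    ultimately have "(b, a) \<in> r"
      using eq_equiv_class[OF _ equiv_cancel_rel] by metis
    then show "a \<in> E"
      using translate_preimage_cancel_rel[OF q] b by (simp add: E_def)
  qed (use translate_preimage_subset in \<open>auto simp: E_def\<close>)
  moreover have "(\<lambda>a. r `` {a}) ` E \<subseteq> S // r"
    using translate_preimage_subset by (auto simp: E_def quotient_eq_image)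
  ultimately have "E \<in> p \<longleftrightarrow> (\<lambda>a. r `` {a}) ` E \<in> beta_map S (S // r) (\<lambda>a. r `` {a}) p"
    and "E \<in> p' \<longleftrightarrow> (\<lambda>a. r `` {a}) ` E \<in> beta_map S (S // r) (\<lambda>a. r `` {a}) p'"
    by (simp_all add: beta_map_def)
  then show "A \<in> beta_mult S mult p q \<longleftrightarrow> A \<in> beta_mult S mult p' q"
    using eq by (simp add: in_beta_mult E_def)
qed

lemma minimal_left_ideals_quotient_isomorphic:
  assumes L: "minimal_left_ideal (beta S) (beta_mult S mult) L"
    and M: "minimal_left_ideal (beta (S // r)) (beta_mult (S // r) (quotient_mult r mult)) M"
  shows "semigroup_isomorphic L (beta_mult S mult) M (beta_mult (S // r) (quotient_mult r mult))"
proof -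
  interpret beta: carrier_semigroup "beta S" "beta_mult S mult"
    by unfold_locales (rule semigroup_beta)
  interpret quot: carrier_semigroup "S // r" "quotient_mult r mult"
    by unfold_locales (rule semigroup_quotient)
  interpret beta_quot: carrier_semigroup "beta (S // r)" "beta_mult (S // r) (quotient_mult r mult)"
    by unfold_locales (rule quot.semigroup_beta)
  define h where "h = beta_map S (S // r) (\<lambda>a. r `` {a})"
  have surj: "h ` beta S = beta (S // r)"
    unfolding h_def by (rule beta_map_image) (simp add: quotient_eq_image)
  have hom: "h (beta_mult S mult p q) = beta_mult (S // r) (quotient_mult r mult) (h p) (h q)" for p q
    unfolding h_def by (rule beta_map_mult) (simp_all add: quotient_eq_image quotient_mult_class)
  obtain e where e: "e \<in> L" "beta_mult S mult e e = e"
    using minimal_left_ideal_beta_idempotent[OF L] by blast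
  have "inj_on h L"
  proof (rule inj_onI)
    fix p q assume p: "p \<in> L" and q: "q \<in> L" and "h p = h q"
    then have "beta_mult S mult p e = beta_mult S mult q e"
      using beta_mult_eq_of_beta_map_eq minimal_left_ideal_subset_common_multiple_ideal[OF L] e(1)
      unfolding h_def by blast
    then show "p = q"
      using beta.idempotent_right_identity[OF L e] p q by simp
  qed
  then have "semigroup_isomorphic L (beta_mult S mult) (h ` L)
      (beta_mult (S // r) (quotient_mult r mult))"
    using hom unfolding semigroup_isomorphic_def bij_betw_def by (intro exI[of _ h]) simp
  moreover have "minimal_left_ideal (beta (S // r)) (beta_mult (S // r) (quotient_mult r mult)) (h ` L)"
    using minimal_left_ideal_image[OF L _ surj] beta.closed hom by simp
  then have "semigroup_isomorphic (h ` L) (beta_mult (S // r) (quotient_mult r mult)) M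
      (beta_mult (S // r) (quotient_mult r mult))"
    by (rule beta_quot.minimal_left_ideals_isomorphic[OF _ M, of _ "h e"]) (use e hom[of e e] in auto)
  ultimately show ?thesis
    by (rule semigroup_isomorphic_trans)
qed

end

theorem theorem3p13:
  fixes S :: "'a set" and m :: "'a \<Rightarrow> 'a \<Rightarrow> 'a"
    and T :: "'a set set" and n :: "'a set \<Rightarrow> 'a set \<Rightarrow> 'a set"
    and L :: "'a set set set" and M :: "'a set set set set"
  assumes "semigroup_on S m"
    and "strong_Folner S m"
    and T_def: "T = S // cancel_rel S m"
    and n_def: "n = quotient_mult (cancel_rel S m) m"
    and "minimal_left_ideal (beta S) (beta_mult S m) L"
    and "minimal_left_ideal (beta T) (beta_mult T n) M"
  shows "semigroup_isomorphic L (beta_mult S m) M (beta_mult T n)"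
proof -
  interpret reversible_semigroup S m
    using assms(1) strong_Folner_reversible[OF assms(2)] by unfold_locales
  show ?thesis
    using minimal_left_ideals_quotient_isomorphic assms by simp
qed

end
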